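(* Let $\mathbf v$ be a complementary symmetric Rote sequence associated with a standard Sturmian sequence $\mathbf u=\mathcal S(\mathbf v)$. Then $\mathbf v$ is primitive substitutive if and only if $\mathbf u$ is primitive substitutive.
   Context: A Sturmian sequence is a sequence over $\{0,1\}$ with factor complexity $n+1$; it is standard if $0\mathbf u,1\mathbf u$ are Sturmian. A complementary symmetric Rote sequence is a sequence over $\{0,1\}$ with factor complexity $2n$ ($n\ge1$) whose set of factors is closed under $0\leftrightarrow1$; it is associated with $\mathcal S(\mathbf v)=u_0u_1\cdots$ where $u_i=v_i+v_{i+1}\bmod 2$. A morphism $\psi$ over an alphabet is primitive if some power of its matrix $M_\psi$ ($(M_\psi)_{ab}=|\psi(a)|_b$) has all entries positive. A sequence $\mathbf w\in\mathcal A^{\mathbb N}$ is primitive substitutive if $\mathbf w=\sigma(\mathbf y)$ for some morphism $\sigma:\mathcal B^*\to\mathcal A^*$ and some sequence $\mathbf y\in\mathcal B^{\mathbb N}$ that is a fixed point of a primitive morphism over $\mathcal B$. *)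

theory Defs
  imports Complex_Main "HOL-Library.Z2" "Jordan_Normal_Form.Matrix"
begin

text \<open>An infinite sequence is a function on \<open>nat\<close>, a finite word is a list, and the alphabet
  \<open>{0,1}\<close> is the type \<^typ>\<open>bit\<close>, whose addition is addition modulo 2.\<close>

definition word_at :: "(nat \<Rightarrow> 'a) \<Rightarrow> nat \<Rightarrow> nat \<Rightarrow> 'a list" where
  "word_at w i n = map w [i..<i + n]"

definition factors :: "(nat \<Rightarrow> 'a) \<Rightarrow> 'a list set" where
  "factors w = {word_at w i n | i n. True}"

definition factor_complexity :: "(nat \<Rightarrow> 'a) \<Rightarrow> nat \<Rightarrow> nat" where
  "factor_complexity w n = card {x \<in> factors w. length x = n}"

definition sturmian :: "(nat \<Rightarrow> bit) \<Rightarrow> bool" where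
  "sturmian u \<longleftrightarrow> (\<forall>n. factor_complexity u n = n + 1)"

text \<open>The sequence \<open>case_nat a u\<close> is \<open>u\<close> with the letter \<open>a\<close> put in front.\<close>

definition standard_sturmian :: "(nat \<Rightarrow> bit) \<Rightarrow> bool" where
  "standard_sturmian u \<longleftrightarrow>
     sturmian u \<and> sturmian (case_nat 0 u) \<and> sturmian (case_nat 1 u)"

definition complementary_symmetric_rote :: "(nat \<Rightarrow> bit) \<Rightarrow> bool" where
  "complementary_symmetric_rote v \<longleftrightarrow>
     (\<forall>n\<ge>1. factor_complexity v n = 2 * n) \<and>
     (\<forall>x \<in> factors v. map (\<lambda>b. b + 1) x \<in> factors v)"

definition \<S> :: "(nat \<Rightarrow> bit) \<Rightarrow> nat \<Rightarrow> bit" where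
  "\<S> v i = v i + v (i + 1)"

text \<open>A morphism between free monoids is given by the images of the letters.\<close>

definition morphism_word :: "('b \<Rightarrow> 'a list) \<Rightarrow> 'b list \<Rightarrow> 'a list" where
  "morphism_word \<sigma> x = concat (map \<sigma> x)"

text \<open>\<open>is_morphic_image \<sigma> y w\<close> states that \<open>w = \<sigma>(y)\<close>. As \<open>\<sigma>\<close> may erase letters,
  \<open>\<sigma>(y)\<close> could be a finite word; the second conjunct excludes this.\<close>

definition is_morphic_image :: "('b \<Rightarrow> 'a list) \<Rightarrow> (nat \<Rightarrow> 'b) \<Rightarrow> (nat \<Rightarrow> 'a) \<Rightarrow> bool" where
  "is_morphic_image \<sigma> y w \<longleftrightarrow>
     (\<forall>n. morphism_word \<sigma> (word_at y 0 n)
            = word_at w 0 (length (morphism_word \<sigma> (word_at y 0 n)))) \<and>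
     (\<forall>N. \<exists>n. length (morphism_word \<sigma> (word_at y 0 n)) \<ge> N)"

text \<open>Up to renaming of letters, a finite alphabet of size \<open>k\<close> is \<open>{..<k}\<close>.\<close>

definition morphism_over :: "nat \<Rightarrow> (nat \<Rightarrow> nat list) \<Rightarrow> bool" where
  "morphism_over k \<psi> \<longleftrightarrow> (\<forall>a<k. set (\<psi> a) \<subseteq> {..<k})"

definition incidence_matrix :: "nat \<Rightarrow> (nat \<Rightarrow> nat list) \<Rightarrow> nat mat" where
  "incidence_matrix k \<psi> = mat k k (\<lambda>(a, b). count_list (\<psi> a) b)"

definition primitive_morphism :: "nat \<Rightarrow> (nat \<Rightarrow> nat list) \<Rightarrow> bool" where
  "primitive_morphism k \<psi> \<longleftrightarrow> morphism_over k \<psi> \<and>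
     (\<exists>m\<ge>1. \<forall>a<k. \<forall>b<k. (incidence_matrix k \<psi> ^\<^sub>m m) $$ (a, b) > 0)"

definition primitive_substitutive :: "(nat \<Rightarrow> 'a) \<Rightarrow> bool" where
  "primitive_substitutive w \<longleftrightarrow>
     (\<exists>k \<psi> y \<sigma>. primitive_morphism k \<psi> \<and> range y \<subseteq> {..<k} \<and>
        is_morphic_image \<psi> y y \<and> is_morphic_image \<sigma> y w)"

end

theory Submission
  imports Defs
begin

text \<open>After replacing the morphism if it maps the first letter to itself, a fixed point \<open>y\<close> of a
  primitive morphism is the same thing as a fixed point in which every letter produces the first
  letter again, and this is easy to check on extended alphabets.

  From \<open>v\<close> to \<open>\<S> v\<close>, pass to the alphabet of pairs \<open>(y n, y (n + 1))\<close>: with a non-erasing coding,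
  a block of \<open>\<S> v\<close> is determined by the corresponding pair.

  From \<open>u = \<S> v = \<sigma>(y)\<close> to \<open>v\<close>, the sequence \<open>v\<close> consists of the partial sums of \<open>u\<close> modulo 2. For a
  letter \<open>a\<close> the sums modulo 2 of \<open>\<sigma>(\<psi>^m(a))\<close> take finitely many values, so after replacing \<open>\<sigma>\<close> by
  \<open>\<sigma> \<circ> \<psi>^m\<close> and \<open>\<psi>\<close> by a power they are invariant under \<open>\<psi>\<close>. Then \<open>\<psi>\<close> lifts to the alphabet of
  pairs of a letter of \<open>y\<close> and the current partial sum. The lift commutes with adding 1 to all
  partial sums, so that if the first letter \<open>(a, s)\<close> produces \<open>(a, s + 1)\<close>, then \<open>(a, s + 1)\<close>
  produces \<open>(a, s)\<close>.\<close>

section \<open>Morphic images\<close>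

lemma length_word_at [simp]: "length (word_at w i n) = n"
  by (simp add: word_at_def)

lemma word_at_0 [simp]: "word_at w i 0 = []"
  by (simp add: word_at_def)

lemma word_at_Suc: "word_at w i (Suc n) = word_at w i n @ [w (i + n)]"
  by (simp add: word_at_def)

lemma word_at_add: "word_at w i (m + n) = word_at w i m @ word_at w (i + m) n"
  by (induction n) (simp_all add: word_at_Suc add.assoc)

lemma nth_word_at [simp]: "j < n \<Longrightarrow> word_at w i n ! j = w (i + j)"
  by (simp add: word_at_def)

lemma set_word_at_subset: "set (word_at w i n) \<subseteq> range w"
  by (auto simp: word_at_def)

lemma map_word_at: "map f (word_at w i n) = word_at (f \<circ> w) i n"
  by (simp add: word_at_def)

lemma morphism_word_Nil [simp]: "morphism_word \<sigma> [] = []"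
  by (simp add: morphism_word_def)

lemma morphism_word_append [simp]:
  "morphism_word \<sigma> (x @ z) = morphism_word \<sigma> x @ morphism_word \<sigma> z"
  by (simp add: morphism_word_def)

lemma morphism_word_Cons [simp]: "morphism_word \<sigma> (a # x) = \<sigma> a @ morphism_word \<sigma> x"
  by (simp add: morphism_word_def)

text \<open>The position in the image at which the block of \<open>y n\<close> begins.\<close>

definition image_length :: "('b \<Rightarrow> 'a list) \<Rightarrow> (nat \<Rightarrow> 'b) \<Rightarrow> nat \<Rightarrow> nat" where
  "image_length \<sigma> y n = length (morphism_word \<sigma> (word_at y 0 n))"

lemma image_length_0 [simp]: "image_length \<sigma> y 0 = 0"
  by (simp add: image_length_def)

lemma image_length_Suc [simp]:
  "image_length \<sigma> y (Suc n) = image_length \<sigma> y n + length (\<sigma> (y n))"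
  by (simp add: image_length_def word_at_Suc)

lemma mono_image_length: "m \<le> n \<Longrightarrow> image_length \<sigma> y m \<le> image_length \<sigma> y n"
  by (induction n rule: dec_induct) auto

text \<open>Consecutive prefixes differ by one block, so the condition on prefixes becomes a
  condition on each block at its own position.\<close>

lemma is_morphic_image_iff_blocks:
  "is_morphic_image \<sigma> y w \<longleftrightarrow>
     (\<forall>n. \<sigma> (y n) = word_at w (image_length \<sigma> y n) (length (\<sigma> (y n)))) \<and>
     (\<forall>N. \<exists>n. N \<le> image_length \<sigma> y n)"
proof -
  let ?P = "\<lambda>n. morphism_word \<sigma> (word_at y 0 n) = word_at w 0 (image_length \<sigma> y n)"
  have step: "?P (Suc n) \<longleftrightarrow> ?P n \<and>
      \<sigma> (y n) = word_at w (image_length \<sigma> y n) (length (\<sigma> (y n)))" for n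
    by (simp add: word_at_Suc word_at_add image_length_def)
  have "(\<forall>n. ?P n) \<longleftrightarrow> (\<forall>n. \<sigma> (y n) = word_at w (image_length \<sigma> y n) (length (\<sigma> (y n))))"
  proof
    assume r: "\<forall>n. \<sigma> (y n) = word_at w (image_length \<sigma> y n) (length (\<sigma> (y n)))"
    have "?P n" for n
    proof (induction n)
      case (Suc n)
      then show ?case using r step by blast
    qed simp
    then show "\<forall>n. ?P n" by blast
  qed (use step in blast)
  then show ?thesis
    by (simp add: is_morphic_image_def image_length_def)
qed

lemma is_morphic_image_prefix:
  "is_morphic_image \<sigma> y w \<Longrightarrow>
    morphism_word \<sigma> (word_at y 0 n) = word_at w 0 (image_length \<sigma> y n)"
  by (simp add: is_morphic_image_def image_length_def)

lemma is_morphic_image_block: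
  "is_morphic_image \<sigma> y w \<Longrightarrow>
    \<sigma> (y n) = word_at w (image_length \<sigma> y n) (length (\<sigma> (y n)))"
  by (simp add: is_morphic_image_iff_blocks)

lemma is_morphic_image_unbounded:
  "is_morphic_image \<sigma> y w \<Longrightarrow> \<exists>n. N \<le> image_length \<sigma> y n"
  by (simp add: is_morphic_image_iff_blocks)

lemma set_image_subset:
  assumes "is_morphic_image \<sigma> y w" and "a \<in> range y"
  shows "set (\<sigma> a) \<subseteq> range w"
proof -
  obtain n where "a = y n" using assms(2) by blast
  then show ?thesis
    using is_morphic_image_block[OF assms(1), of n] set_word_at_subset by metis
qed

text \<open>The graph underlying the incidence matrix, without multiplicities; paths of length
  \<open>n\<close> record which letters occur in the \<open>n\<close>-th iterate.\<close>

definition letter_rel :: "('b \<Rightarrow> 'b list) \<Rightarrow> 'b rel" where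
  "letter_rel \<psi> = {(a, b). b \<in> set (\<psi> a)}"

lemma letter_rel_iff [simp]: "(a, b) \<in> letter_rel \<psi> \<longleftrightarrow> b \<in> set (\<psi> a)"
  by (simp add: letter_rel_def)

lemma letter_rel_closed:
  assumes "is_morphic_image \<psi> y y" and "(a, b) \<in> (letter_rel \<psi>)\<^sup>*" and "a \<in> range y"
  shows "b \<in> range y"
  using assms(2,3)
proof (induction rule: rtrancl_induct)
  case (step b c)
  then show ?case
    using set_image_subset[OF assms(1), of b] by (meson letter_rel_iff subsetD)
qed

lemma hd_image:
  assumes "is_morphic_image \<sigma> y w" and "\<sigma> (y n) \<noteq> []"
  shows "hd (\<sigma> (y n)) = w (image_length \<sigma> y n)"
  using is_morphic_image_block[OF assms(1), of n] assms(2)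
  by (metis add.right_neutral hd_conv_nth length_greater_0_conv nth_word_at)

lemma image_length_cong:
  assumes "\<And>i. length (\<sigma>' (y' i)) = length (\<sigma> (y i))"
  shows "image_length \<sigma>' y' n = image_length \<sigma> y n"
  by (induction n) (simp_all add: assms)

text \<open>Block positions depend only on block lengths, so a change of alphabet that keeps these
  lengths can be verified locally.\<close>

lemma is_morphic_image_transfer:
  assumes "is_morphic_image \<sigma> y w"
    and "\<And>n. \<sigma>' (y' n) = word_at w' (image_length \<sigma> y n) (length (\<sigma> (y n)))"
  shows "is_morphic_image \<sigma>' y' w'"
proof -
  have "image_length \<sigma>' y' n = image_length \<sigma> y n" for n
    by (rule image_length_cong) (simp add: assms(2))
  then show ?thesis
    using assms unfolding is_morphic_image_iff_blocks by simp
qed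

lemma is_morphic_image_map:
  assumes "is_morphic_image \<sigma> y w"
  shows "is_morphic_image (\<lambda>a. map f (\<sigma> a)) y (f \<circ> w)"
  using assms
proof (rule is_morphic_image_transfer)
  fix n
  show "map f (\<sigma> (y n)) = word_at (f \<circ> w) (image_length \<sigma> y n) (length (\<sigma> (y n)))"
    by (subst is_morphic_image_block[OF assms]) (simp add: map_word_at)
qed

section \<open>Composition and powers of morphisms\<close>

definition morphism_comp :: "('b \<Rightarrow> 'a list) \<Rightarrow> ('c \<Rightarrow> 'b list) \<Rightarrow> 'c \<Rightarrow> 'a list" where
  "morphism_comp \<sigma> \<tau> a = morphism_word \<sigma> (\<tau> a)"

lemma morphism_word_comp:
  "morphism_word (morphism_comp \<sigma> \<tau>) x = morphism_word \<sigma> (morphism_word \<tau> x)"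
  by (induction x) (simp_all add: morphism_comp_def)

lemma is_morphic_image_comp:
  assumes \<tau>: "is_morphic_image \<tau> x y" and \<sigma>: "is_morphic_image \<sigma> y w"
  shows "is_morphic_image (morphism_comp \<sigma> \<tau>) x w"
proof -
  have eq: "morphism_word (morphism_comp \<sigma> \<tau>) (word_at x 0 n)
      = morphism_word \<sigma> (word_at y 0 (image_length \<tau> x n))" for n
    by (simp add: morphism_word_comp is_morphic_image_prefix[OF \<tau>])
  have "\<exists>n. N \<le> image_length \<sigma> y (image_length \<tau> x n)" for N
    by (meson is_morphic_image_unbounded[OF \<tau>] is_morphic_image_unbounded[OF \<sigma>]
        mono_image_length order_trans)
  then show ?thesis
    unfolding is_morphic_image_def eq is_morphic_image_prefix[OF \<sigma>] by simp
qed

text \<open>The morphism \<sigma> composed with the \<open>n\<close>-th power of \<psi>; with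
  \<open>\<lambda>a. [a]\<close> for \<open>\<sigma>\<close> it is that power itself.\<close>

primrec comp_power :: "nat \<Rightarrow> ('b \<Rightarrow> 'a list) \<Rightarrow> ('b \<Rightarrow> 'b list) \<Rightarrow> 'b \<Rightarrow> 'a list" where
  "comp_power 0 \<sigma> \<psi> = \<sigma>"
| "comp_power (Suc n) \<sigma> \<psi> = morphism_comp (comp_power n \<sigma> \<psi>) \<psi>"

lemma comp_power_add:
  "comp_power (m + n) \<sigma> \<psi> = morphism_comp (comp_power m \<sigma> \<psi>) (comp_power n (\<lambda>a. [a]) \<psi>)"
proof (induction n)
  case 0
  show ?case by (simp add: fun_eq_iff morphism_comp_def)
next
  case (Suc n)
  show ?case
  proof
    fix a
    have "comp_power (m + Suc n) \<sigma> \<psi> a = morphism_word (comp_power (m + n) \<sigma> \<psi>) (\<psi> a)"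
      by (simp add: morphism_comp_def)
    also have "\<dots> = morphism_word (comp_power m \<sigma> \<psi>)
        (morphism_word (comp_power n (\<lambda>a. [a]) \<psi>) (\<psi> a))"
      by (simp only: Suc.IH morphism_word_comp)
    also have "\<dots> = morphism_comp (comp_power m \<sigma> \<psi>) (comp_power (Suc n) (\<lambda>a. [a]) \<psi>) a"
      by (simp add: morphism_comp_def)
    finally show "comp_power (m + Suc n) \<sigma> \<psi> a
      = morphism_comp (comp_power m \<sigma> \<psi>) (comp_power (Suc n) (\<lambda>a. [a]) \<psi>) a" .
  qed
qed

lemma set_comp_power:
  "set (comp_power n \<sigma> \<psi> a) = (\<Union>b \<in> {b. (a, b) \<in> letter_rel \<psi> ^^ n}. set (\<sigma> b))"
proof (induction n arbitrary: a)
  case (Suc n)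
  have "set (comp_power (Suc n) \<sigma> \<psi> a) = (\<Union>c \<in> set (\<psi> a). set (comp_power n \<sigma> \<psi> c))"
    by (simp add: morphism_comp_def morphism_word_def)
  \<comment> \<open>\<open>comp_power\<close> splits off the first step of a path and
    \<open>relpow\<close> the last one; commuting the powers reconciles the two.\<close>
  also have "\<dots> = (\<Union>b \<in> {b. (a, b) \<in> letter_rel \<psi> ^^ Suc n}. set (\<sigma> b))"
    unfolding Suc.IH relpow.simps(2) relpow_commute[symmetric] by (auto simp: relcomp_unfold)
  finally show ?case .
qed simp

lemma letter_rel_comp_power: "letter_rel (comp_power n (\<lambda>a. [a]) \<psi>) = letter_rel \<psi> ^^ n"
  by (auto simp: set_comp_power)

lemma is_morphic_image_comp_power:
  assumes "is_morphic_image \<psi> y y" and "is_morphic_image \<sigma> y w"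
  shows "is_morphic_image (comp_power n \<sigma> \<psi>) y w"
  by (induction n) (simp_all add: assms is_morphic_image_comp[OF assms(1)])

lemma is_morphic_image_id: "is_morphic_image (\<lambda>a. [a]) y y"
proof -
  have "image_length (\<lambda>a. [a]) y n = n" for n
    by (induction n) simp_all
  then show ?thesis
    by (auto simp: is_morphic_image_iff_blocks word_at_def)
qed

section \<open>Fixed points whose letters all produce the first letter\<close>

text \<open>Since \<open>\<psi> (y 0)\<close> has at least two letters and no letter is erased, position \<open>i > 0\<close> lies
  in the image of some \<open>y j\<close> with \<open>j < i\<close>.\<close>

lemma reachable_from_first:
  assumes fixed: "is_morphic_image \<psi> y y" and len: "length (\<psi> (y 0)) \<ge> 2"
    and ne: "\<And>n. \<psi> (y n) \<noteq> []"
  shows "(y 0, y i) \<in> (letter_rel \<psi>)\<^sup>*"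
proof (induction i rule: less_induct)
  case (less i)
  show ?case
  proof (cases i)
    case (Suc k)
    have "n + 2 \<le> image_length \<psi> y (Suc n)" for n
    proof (induction n)
      case (Suc n)
      have "length (\<psi> (y (Suc n))) \<ge> 1"
        using ne by (simp add: Suc_le_eq)
      then show ?case using Suc by simp
    qed (use len in simp)
    then have "i < image_length \<psi> y i"
      by (metis Suc Suc_le_eq add_2_eq_Suc')
    then have "y i \<in> set (morphism_word \<psi> (word_at y 0 i))"
      unfolding is_morphic_image_prefix[OF fixed] by (simp add: word_at_def)
    then obtain j where "j < i" "y i \<in> set (\<psi> (y j))"
      by (auto simp: morphism_word_def word_at_def)
    then show ?thesis
      using less.IH by (meson letter_rel_iff rtrancl.rtrancl_into_rtrancl)
  qed simp
qed

text \<open>Only occurring letters are constrained. The paths back exclude erasing, and then the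
  length condition makes every letter reachable from \<open>y 0\<close>, which gives strong
  connectivity.\<close>

definition returning_fixed_point :: "('b \<Rightarrow> 'b list) \<Rightarrow> (nat \<Rightarrow> 'b) \<Rightarrow> bool" where
  "returning_fixed_point \<psi> y \<longleftrightarrow>
     finite (range y) \<and> is_morphic_image \<psi> y y \<and> length (\<psi> (y 0)) \<ge> 2 \<and>
     (\<forall>a \<in> range y. (a, y 0) \<in> (letter_rel \<psi>)\<^sup>*)"

context
  fixes \<psi> :: "'b \<Rightarrow> 'b list" and y :: "nat \<Rightarrow> 'b"
  assumes ret: "returning_fixed_point \<psi> y"
begin

lemma returning_fixed: "is_morphic_image \<psi> y y"
  and returning_finite: "finite (range y)"
  and returning_length: "length (\<psi> (y 0)) \<ge> 2"
  and returning_to_first: "a \<in> range y \<Longrightarrow> (a, y 0) \<in> (letter_rel \<psi>)\<^sup>*"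
  using ret by (auto simp: returning_fixed_point_def)

text \<open>The path to \<open>y 0\<close> is either empty, and then the length condition applies,
  or leaves \<open>a\<close> through a letter of \<open>\<psi> a\<close>.\<close>

lemma returning_nonerasing: "a \<in> range y \<Longrightarrow> \<psi> a \<noteq> []"
  using returning_to_first[of a] returning_length by (cases rule: converse_rtranclE) auto

lemma returning_prefix: "\<exists>z. \<psi> (y 0) = y 0 # y 1 # z"
proof -
  obtain l where l: "length (\<psi> (y 0)) = 2 + l"
    using returning_length le_Suc_ex by blast
  have "\<psi> (y 0) = word_at y 0 (2 + l)"
    using is_morphic_image_block[OF returning_fixed, of 0] by (simp add: l)
  then show ?thesis
    unfolding word_at_add by (simp add: numeral_2_eq_2 word_at_Suc)
qed

lemma returning_loop: "y 0 \<in> set (\<psi> (y 0))"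
  using returning_prefix by auto

lemma returning_loop_power: "(y 0, y 0) \<in> letter_rel \<psi> ^^ n"
proof (induction n)
  case (Suc n)
  then show ?case using returning_loop by (intro relpow_Suc_I) auto
qed simp

text \<open>The loop at \<open>y 0\<close> lengthens a path ending there by any number of steps;
  this is the source of aperiodicity.\<close>

lemma returning_power_mono:
  assumes "(a, y 0) \<in> letter_rel \<psi> ^^ m" and "m \<le> n"
  shows "(a, y 0) \<in> letter_rel \<psi> ^^ n"
proof -
  have "(a, y 0) \<in> letter_rel \<psi> ^^ m O letter_rel \<psi> ^^ (n - m)"
    using assms(1) returning_loop_power by (rule relcompI)
  then show ?thesis using assms(2) by (simp flip: relpow_add)
qed

text \<open>Go to \<open>y 0\<close>, wait at its loop, and go on to \<open>b\<close>, with one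
  total length for all pairs of letters.\<close>

lemma returning_primitive:
  "\<exists>N\<ge>1. \<forall>a \<in> range y. \<forall>b \<in> range y. (a, b) \<in> letter_rel \<psi> ^^ N"
proof -
  have "\<exists>m. \<forall>a \<in> range y. (a, y 0) \<in> letter_rel \<psi> ^^ m a"
    using returning_to_first by (intro bchoice) (simp add: rtrancl_power)
  then obtain m where m: "\<forall>a \<in> range y. (a, y 0) \<in> letter_rel \<psi> ^^ m a" by blast
  have "\<exists>l. \<forall>b \<in> range y. (y 0, b) \<in> letter_rel \<psi> ^^ l b"
    using reachable_from_first[OF returning_fixed returning_length] returning_nonerasing
    by (intro bchoice) (auto simp: rtrancl_power)
  then obtain l where l: "\<forall>b \<in> range y. (y 0, b) \<in> letter_rel \<psi> ^^ l b" by blast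
  define M where "M = Max (m ` range y)"
  \<comment> \<open>\<open>Suc\<close> makes the exponent positive even if all chosen paths are
    empty.\<close>
  define L where "L = Suc (Max (l ` range y))"
  have M: "m a \<le> M" if "a \<in> range y" for a
    unfolding M_def using that returning_finite by (intro Max_ge) auto
  have L: "l b \<le> L" if "b \<in> range y" for b
    unfolding L_def using that returning_finite by (intro le_SucI Max_ge) auto
  have "(a, b) \<in> letter_rel \<psi> ^^ (M + L)" if a: "a \<in> range y" and b: "b \<in> range y" for a b
  proof -
    have "(a, y 0) \<in> letter_rel \<psi> ^^ (M + (L - l b))"
      by (rule returning_power_mono[OF bspec[OF m a] trans_le_add1[OF M[OF a]]])
    then have "(a, b) \<in> letter_rel \<psi> ^^ (M + (L - l b)) O letter_rel \<psi> ^^ l b"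
      using bspec[OF l b] by (rule relcompI)
    then show ?thesis using L[OF b] by (simp flip: relpow_add)
  qed
  moreover have "M + L \<ge> 1" by (simp add: L_def)
  ultimately show ?thesis by blast
qed

text \<open>A path of length \<open>m\<close> to \<open>y 0\<close> extends at the loop to length
  \<open>n * m\<close>, which amounts to \<open>m\<close> steps of the power.\<close>

lemma returning_comp_power:
  assumes "n \<ge> 1"
  shows "returning_fixed_point (comp_power n (\<lambda>a. [a]) \<psi>) y"
  unfolding returning_fixed_point_def
proof (intro conjI ballI)
  show "finite (range y)" by (rule returning_finite)
  show fixed: "is_morphic_image (comp_power k (\<lambda>a. [a]) \<psi>) y y" for k
    by (intro is_morphic_image_comp_power returning_fixed is_morphic_image_id)
  show to: "(a, y 0) \<in> (letter_rel (comp_power n (\<lambda>a. [a]) \<psi>))\<^sup>*" if a: "a \<in> range y" for a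
  proof -
    obtain m where m: "(a, y 0) \<in> letter_rel \<psi> ^^ m"
      using returning_to_first[OF a] by (auto simp: rtrancl_power)
    have "m \<le> n * m" using assms by simp
    moreover have "(letter_rel \<psi> ^^ n) ^^ m = letter_rel \<psi> ^^ (n * m)"
      by (induction m) (simp_all add: add.commute flip: relpow_add)
    ultimately have "(a, y 0) \<in> (letter_rel \<psi> ^^ n) ^^ m"
      using returning_power_mono[OF m] by simp
    then show ?thesis
      unfolding letter_rel_comp_power by (rule relpow_imp_rtrancl)
  qed
  obtain k where k: "n = Suc k" using assms by (cases n) auto
  \<comment> \<open>The \<open>n\<close>-th iterate of \<open>y 0\<close> contains the
    \<open>k\<close>-th iterates of \<open>y 0\<close> and \<open>y 1\<close>; as these are
    nonempty, it has at least two letters.\<close>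
  have ne: "comp_power k (\<lambda>a. [a]) \<psi> a \<noteq> []" if "a \<in> range y" for a
    using that
  proof (induction k arbitrary: a)
    case (Suc k)
    obtain b x where b: "\<psi> a = b # x" using returning_nonerasing[OF Suc.prems]
      by (cases "\<psi> a") auto
    then have "b \<in> range y" using set_image_subset[OF returning_fixed Suc.prems] by auto
    with b Suc.IH show ?case by (simp add: morphism_comp_def)
  qed simp
  obtain z where z: "\<psi> (y 0) = y 0 # y 1 # z" using returning_prefix by blast
  have "length (comp_power k (\<lambda>a. [a]) \<psi> (y 0)) \<ge> 1" "length (comp_power k (\<lambda>a. [a]) \<psi> (y 1)) \<ge> 1"
    using ne by (simp_all add: Suc_le_eq)
  then show "length (comp_power n (\<lambda>a. [a]) \<psi> (y 0)) \<ge> 2"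
    by (simp add: k morphism_comp_def z)
qed

text \<open>An infinite image needs a letter that \<open>\<sigma>\<close> does not erase, and a
  suitable iterate of every letter contains it. So \<open>\<sigma>\<close> is composed with that
  iterate.\<close>

lemma returning_nonerasing_coding:
  assumes "is_morphic_image \<sigma> y w"
  obtains \<tau> where "is_morphic_image \<tau> y w" "\<And>a. a \<in> range y \<Longrightarrow> \<tau> a \<noteq> []"
proof -
  obtain N where N: "\<forall>a \<in> range y. \<forall>b \<in> range y. (a, b) \<in> letter_rel \<psi> ^^ N"
    using returning_primitive by blast
  have "\<exists>i. \<sigma> (y i) \<noteq> []"
  proof (rule ccontr)
    assume "\<nexists>i. \<sigma> (y i) \<noteq> []"
    then have "image_length \<sigma> y n = 0" for n by (induction n) simp_all
    then show False using is_morphic_image_unbounded[OF assms, of 1] by simp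
  qed
  then obtain i where i: "\<sigma> (y i) \<noteq> []" by blast
  have "comp_power N \<sigma> \<psi> a \<noteq> []" if "a \<in> range y" for a
  proof -
    have "set (comp_power N \<sigma> \<psi> a) \<noteq> {}"
      using N that i by (auto simp: set_comp_power)
    then show ?thesis by auto
  qed
  then show ?thesis
    using that is_morphic_image_comp_power[OF returning_fixed assms] by blast
qed

end

section \<open>Relation to primitive morphisms\<close>

text \<open>Entries are natural numbers, so nothing cancels: an entry of a product is positive
  exactly when some summand is, that is, when some path exists.\<close>

lemma incidence_matrix_power_pos_iff:
  assumes "morphism_over k \<psi>" and "a < k" and "b < k"
  shows "(incidence_matrix k \<psi> ^\<^sub>m m) $$ (a, b) > 0 \<longleftrightarrow> (a, b) \<in> letter_rel \<psi> ^^ m"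
  using assms(3)
proof (induction m arbitrary: b)
  case 0
  then show ?case using assms(2) by (simp add: incidence_matrix_def)
next
  case (Suc m)
  let ?M = "incidence_matrix k \<psi>"
  have dims: "?M \<in> carrier_mat k k" "?M ^\<^sub>m m \<in> carrier_mat k k"
    by (simp_all add: incidence_matrix_def)
  \<comment> \<open>Paths from \<open>a\<close> never leave the alphabet, so the sum over
    \<open>c<k\<close> sees every intermediate letter.\<close>
  have closed: "c < k" if "(a, c) \<in> letter_rel \<psi> ^^ m" for c
    using that
  proof (induction m arbitrary: c)
    case (Suc m)
    then obtain d where "(a, d) \<in> letter_rel \<psi> ^^ m" "c \<in> set (\<psi> d)" by auto
    then show ?case using assms(1) Suc.IH[of d] by (auto simp: morphism_over_def)
  qed (use assms(2) in simp)
  have pos: "?M $$ (c, b) > 0 \<longleftrightarrow> b \<in> set (\<psi> c)" if "c < k" for c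
    using that Suc.prems count_list_0_iff[of "\<psi> c" b]
    by (auto simp: incidence_matrix_def simp flip: neq0_conv)
  have prod: "(?M ^\<^sub>m Suc m) $$ (a, b) = (\<Sum>c<k. (?M ^\<^sub>m m) $$ (a, c) * ?M $$ (c, b))"
    using dims assms(2) Suc.prems by (simp add: scalar_prod_def atLeast0LessThan)
  have "(?M ^\<^sub>m Suc m) $$ (a, b) > 0 \<longleftrightarrow> (\<exists>c<k. (?M ^\<^sub>m m) $$ (a, c) > 0 \<and> ?M $$ (c, b) > 0)"
    unfolding prod by (auto simp flip: neq0_conv)
  also have "\<dots> \<longleftrightarrow> (\<exists>c<k. (a, c) \<in> letter_rel \<psi> ^^ m \<and> b \<in> set (\<psi> c))"
    using Suc.IH pos by blast
  also have "\<dots> \<longleftrightarrow> (a, b) \<in> letter_rel \<psi> ^^ Suc m"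
    by (simp add: relcomp_unfold) (metis closed)
  finally show ?case .
qed

text \<open>The letters that occur in \<open>y\<close> are numbered from 0, and
  \<open>\<psi>\<close> is conjugated by this numbering. Other elements of the letter type carry no
  hypothesis and are left out.\<close>

lemma returning_imp_primitive_substitutive:
  fixes y :: "nat \<Rightarrow> 'b"
  assumes ret: "returning_fixed_point \<psi> y" and \<sigma>: "is_morphic_image \<sigma> y w"
  shows "primitive_substitutive w"
proof -
  let ?A = "range y"
  define k where "k = card ?A"
  obtain f where f: "bij_betw f ?A {..<k}"
    using ex_bij_betw_finite_nat[OF returning_finite[OF ret]]
    by (auto simp: k_def atLeast0LessThan)
  define g where "g = inv_into ?A f"
  have gf: "g (f a) = a" if "a \<in> ?A" for a
    using f that by (simp add: g_def bij_betw_inv_into_left)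
  have fg: "f (g i) = i" "g i \<in> ?A" if "i < k" for i
    using f that bij_betw_inv_into[OF f]
    by (auto simp: g_def bij_betw_inv_into_right dest: bij_betwE)
  have f_less: "f a < k" if "a \<in> ?A" for a
    using f that by (auto dest: bij_betwE)
  define \<psi>' where "\<psi>' i = map f (\<psi> (g i))" for i
  have over: "morphism_over k \<psi>'"
    unfolding morphism_over_def
  proof (intro allI impI)
    fix i assume "i < k"
    then have "set (\<psi> (g i)) \<subseteq> ?A"
      using set_image_subset[OF returning_fixed[OF ret]] fg(2) by blast
    then have "f ` set (\<psi> (g i)) \<subseteq> {..<k}" using f_less by blast
    then show "set (\<psi>' i) \<subseteq> {..<k}" by (simp add: \<psi>'_def)
  qed
  have rel: "(f a, f b) \<in> letter_rel \<psi>' ^^ n"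
    if "a \<in> ?A" and "(a, b) \<in> letter_rel \<psi> ^^ n" for a b n
    using that(2)
  proof (induction n arbitrary: b)
    case (Suc n)
    then obtain c where c: "(a, c) \<in> letter_rel \<psi> ^^ n" "b \<in> set (\<psi> c)" by auto
    then have "c \<in> ?A"
      using letter_rel_closed[OF returning_fixed[OF ret] _ that(1)] relpow_imp_rtrancl by blast
    then have "f b \<in> set (\<psi>' (f c))" using c(2) by (simp add: \<psi>'_def gf)
    then show ?case using Suc.IH[OF c(1)] by auto
  qed simp
  obtain N where N: "N \<ge> 1" "\<forall>a \<in> ?A. \<forall>b \<in> ?A. (a, b) \<in> letter_rel \<psi> ^^ N"
    using returning_primitive[OF ret] by blast
  have "(i, j) \<in> letter_rel \<psi>' ^^ N" if "i < k" "j < k" for i j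
    using rel[of "g i" "g j" N] N(2) fg that by metis
  then have "primitive_morphism k \<psi>'"
    unfolding primitive_morphism_def using over N(1) incidence_matrix_power_pos_iff by blast
  moreover have "range (f \<circ> y) \<subseteq> {..<k}" using f_less by auto
  moreover have "is_morphic_image \<psi>' (f \<circ> y) (f \<circ> y)"
    by (rule is_morphic_image_transfer[OF is_morphic_image_map[OF returning_fixed[OF ret], of f]])
      (subst is_morphic_image_block[OF is_morphic_image_map[OF returning_fixed[OF ret], of f],
          symmetric], simp add: \<psi>'_def gf)
  moreover have "is_morphic_image (\<sigma> \<circ> g) (f \<circ> y) w"
    by (rule is_morphic_image_transfer[OF \<sigma>])
      (subst is_morphic_image_block[OF \<sigma>, symmetric], simp add: gf)
  ultimately show ?thesis
    unfolding primitive_substitutive_def by blast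
qed

text \<open>Primitivity already connects all letters, so only the length condition can fail; then
  \<open>y\<close> is constant and another morphism takes over.\<close>

lemma primitive_substitutive_imp_returning:
  assumes "primitive_substitutive w"
  obtains \<psi> and y :: "nat \<Rightarrow> nat" and \<sigma>
  where "returning_fixed_point \<psi> y" "is_morphic_image \<sigma> y w"
proof -
  obtain k \<psi> y \<sigma> where prim: "primitive_morphism k \<psi>" and y: "range y \<subseteq> {..<k}"
    and fixed: "is_morphic_image \<psi> y y" and \<sigma>: "is_morphic_image \<sigma> y w"
    using assms unfolding primitive_substitutive_def by blast
  obtain m where m: "m \<ge> 1" "\<And>a b. a < k \<Longrightarrow> b < k \<Longrightarrow> (a, b) \<in> letter_rel \<psi> ^^ m"
    using prim incidence_matrix_power_pos_iff unfolding primitive_morphism_def by blast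
  have y_less: "y i < k" for i using y by auto
  have fin: "finite (range y)" using y finite_subset by blast
  show ?thesis
  proof (cases "length (\<psi> (y 0)) \<ge> 2")
    case True
    have "(a, y 0) \<in> (letter_rel \<psi>)\<^sup>*" if "a \<in> range y" for a
      using that m(2) y_less relpow_imp_rtrancl by blast
    then have "returning_fixed_point \<psi> y"
      using fin fixed True by (simp add: returning_fixed_point_def)
    then show ?thesis using \<sigma> that by blast
  next
    case False
    \<comment> \<open>Since \<open>m\<close> is positive, there is a first step out of
      \<open>y 0\<close>, so its image is not empty.\<close>
    have "(y 0, y 0) \<in> letter_rel \<psi> ^^ Suc (m - 1)" using m y_less by simp
    then have "\<psi> (y 0) \<noteq> []" by (metis empty_iff letter_rel_iff list.set(1) relpow_Suc_D2)
    then have "\<psi> (y 0) = [y 0]"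
      using False hd_image[OF fixed, of 0] by (cases "\<psi> (y 0)") (auto simp: not_less_eq_eq)
    then have "b = y 0" if "(y 0, b) \<in> letter_rel \<psi> ^^ n" for n b
      using that
    proof (induction n arbitrary: b)
      case (Suc n)
      then obtain c where "(y 0, c) \<in> letter_rel \<psi> ^^ n" "b \<in> set (\<psi> c)" by auto
      then show ?case using \<open>\<psi> (y 0) = [y 0]\<close> Suc.IH[of c] by simp
    qed simp
    \<comment> \<open>Only \<open>y 0\<close> is reachable from \<open>y 0\<close>, whereas
      primitivity makes every letter reachable.\<close>
    then have const: "y i = y 0" for i using m(2) y_less by metis
    define c where "c = y 0"
    have y_c: "y = (\<lambda>_. c)"
      unfolding c_def by (rule ext) (rule const)
    \<comment> \<open>Doubling the only letter fixes the constant sequence and satisfies the length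
      condition.\<close>
    have len: "image_length (\<lambda>_. [c, c]) (\<lambda>_. c) n = 2 * n" for n
      by (induction n) simp_all
    have "\<exists>n. N \<le> 2 * n" for N :: nat by (rule exI[of _ N]) simp
    then have "is_morphic_image (\<lambda>_. [c, c]) y y"
      unfolding is_morphic_image_iff_blocks y_c len by (simp add: numeral_2_eq_2 word_at_Suc)
    then have "returning_fixed_point (\<lambda>_. [c, c]) y"
      by (simp add: returning_fixed_point_def y_c)
    then show ?thesis using \<sigma> that by blast
  qed
qed

section \<open>Lifts to extended alphabets\<close>

text \<open>Steps lift one at a time, but the second component of the end is not prescribed. Each
  extension below needs its own argument to end exactly at the first letter.\<close>

lemma rtrancl_lift:
  assumes "\<And>x. map fst (\<psi>' x) = \<psi> (fst x)"
    and "(a, b) \<in> (letter_rel \<psi>)\<^sup>*"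
  shows "\<exists>t. ((a, s), (b, t)) \<in> (letter_rel \<psi>')\<^sup>*"
  using assms(2)
proof (induction rule: rtrancl_induct)
  case (step b c)
  then obtain t where t: "((a, s), (b, t)) \<in> (letter_rel \<psi>')\<^sup>*" by blast
  have "c \<in> fst ` set (\<psi>' (b, t))"
    using step.hyps(2) assms(1)[of "(b, t)"] by (metis fst_conv letter_rel_iff list.set_map)
  then obtain t' where "((b, t), (c, t')) \<in> letter_rel \<psi>'" by auto
  with t show ?case by (meson rtrancl.rtrancl_into_rtrancl)
qed blast

section \<open>Pairs of consecutive letters\<close>

text \<open>The morphism of the 2-block presentation: if no image is empty, it lists the factors of
  length 2 that begin inside the image of \<open>a\<close> when the image of \<open>b\<close>
  follows.\<close>

definition pair_morphism :: "('b \<Rightarrow> 'a list) \<Rightarrow> 'b \<times> 'b \<Rightarrow> ('a \<times> 'a) list" where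
  "pair_morphism \<sigma> = (\<lambda>(a, b). zip (\<sigma> a) (tl (\<sigma> a) @ [hd (\<sigma> b)]))"

definition pair_sequence :: "(nat \<Rightarrow> 'a) \<Rightarrow> nat \<Rightarrow> 'a \<times> 'a" where
  "pair_sequence w n = (w n, w (Suc n))"

lemma is_morphic_image_pair:
  assumes im: "is_morphic_image \<sigma> y w" and ne: "\<And>a. a \<in> range y \<Longrightarrow> \<sigma> a \<noteq> []"
  shows "is_morphic_image (pair_morphism \<sigma>) (pair_sequence y) (pair_sequence w)"
  using im
proof (rule is_morphic_image_transfer)
  fix n
  let ?L = "image_length \<sigma> y n" and ?l = "length (\<sigma> (y n))"
  have blk: "\<sigma> (y n) = word_at w ?L ?l" by (rule is_morphic_image_block[OF im])
  have nth: "\<sigma> (y n) ! i = w (?L + i)" if "i < ?l" for i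
    using blk that by (metis nth_word_at)
  have pos: "?l > 0" using ne by simp
  have hd: "hd (\<sigma> (y (Suc n))) = w (?L + ?l)"
    using hd_image[OF im, of "Suc n"] ne by simp
  \<comment> \<open>Inside a block the successor is the next letter of the block; after the last
    letter it is the first letter of the next, nonempty block.\<close>
  have "(tl (\<sigma> (y n)) @ [hd (\<sigma> (y (Suc n)))]) ! i = w (Suc (?L + i))" if "i < ?l" for i
  proof (cases "Suc i < ?l")
    case True
    then have "i < ?l - 1" by simp
    then show ?thesis using nth[OF True] by (simp add: nth_append nth_tl)
  next
    case False
    then have i: "?l = Suc i" using that by simp
    then have "\<not> i < length (tl (\<sigma> (y n)))" "i - length (tl (\<sigma> (y n))) = 0" by simp_all
    then show ?thesis using hd by (simp add: nth_append i)
  qed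
  then show "pair_morphism \<sigma> (pair_sequence y n) = word_at (pair_sequence w) ?L ?l"
    using pos nth by (intro nth_equalityI) (auto simp: pair_morphism_def pair_sequence_def)
qed

lemma map_fst_pair_morphism: "map fst (pair_morphism \<sigma> x) = \<sigma> (fst x)"
  by (cases "\<sigma> (fst x)") (auto simp: pair_morphism_def case_prod_beta)

lemma returning_pair:
  assumes ret: "returning_fixed_point \<psi> y"
  shows "returning_fixed_point (pair_morphism \<psi>) (pair_sequence y)"
  unfolding returning_fixed_point_def
proof (intro conjI ballI)
  have "range (pair_sequence y) \<subseteq> range y \<times> range y" by (auto simp: pair_sequence_def)
  then show "finite (range (pair_sequence y))"
    using returning_finite[OF ret] by (meson finite_SigmaI finite_subset)
  show "is_morphic_image (pair_morphism \<psi>) (pair_sequence y) (pair_sequence y)"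
    by (intro is_morphic_image_pair returning_fixed[OF ret] returning_nonerasing[OF ret])
  have "length (pair_morphism \<psi> x) = length (\<psi> (fst x))" for x
    by (metis length_map map_fst_pair_morphism)
  then show "length (pair_morphism \<psi> (pair_sequence y 0)) \<ge> 2"
    using returning_length[OF ret] by (simp add: pair_sequence_def)
next
  fix x assume "x \<in> range (pair_sequence y)"
  then obtain n where x: "x = (y n, y (Suc n))" by (auto simp: pair_sequence_def)
  obtain c where c: "(x, (y 0, c)) \<in> (letter_rel (pair_morphism \<psi>))\<^sup>*"
    using rtrancl_lift[of "pair_morphism \<psi>" \<psi>, OF map_fst_pair_morphism returning_to_first[OF ret]] x
    by blast
  \<comment> \<open>The image of \<open>(y 0, c)\<close> begins with \<open>(y 0, y 1)\<close>
    whatever \<open>c\<close> is, so one more step reaches the first pair.\<close>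
  obtain z where "\<psi> (y 0) = y 0 # y 1 # z" using returning_prefix[OF ret] by blast
  then have "((y 0, c), pair_sequence y 0) \<in> letter_rel (pair_morphism \<psi>)"
    by (simp add: pair_morphism_def pair_sequence_def)
  with c show "(x, pair_sequence y 0) \<in> (letter_rel (pair_morphism \<psi>))\<^sup>*"
    by (meson rtrancl.rtrancl_into_rtrancl)
qed

section \<open>Letters extended by partial sums\<close>

primrec running :: "('b \<Rightarrow> 's::comm_monoid_add) \<Rightarrow> 's \<Rightarrow> 'b list \<Rightarrow> ('b \<times> 's) list" where
  "running h s [] = []"
| "running h s (a # x) = (a, s) # running h (s + h a) x"

lemma running_append:
  "running h s (x @ z) = running h s x @ running h (s + sum_list (map h x)) z"
  by (induction x arbitrary: s) (simp_all add: add.assoc)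

lemma length_running [simp]: "length (running h s x) = length x"
  by (induction x arbitrary: s) simp_all

lemma map_fst_running [simp]: "map fst (running h s x) = x"
  by (induction x arbitrary: s) simp_all

text \<open>The translation symmetry of the lift, by which paths between extended letters can be
  shifted.\<close>

lemma running_shift: "running h (s + c) x = map (\<lambda>(a, t). (a, t + c)) (running h s x)"
proof (induction x arbitrary: s)
  case (Cons a x)
  show ?case using Cons[of "s + h a"] by (simp add: ac_simps)
qed simp

lemma running_word_at:
  assumes "\<And>i. t (Suc i) = t i + h (y i)"
  shows "running h (t i) (word_at y i n) = word_at (\<lambda>i. (y i, t i)) i n"
    and "t (i + n) = t i + sum_list (map h (word_at y i n))"
proof (induction n)
  case (Suc n)
  show "t (i + Suc n) = t i + sum_list (map h (word_at y i (Suc n)))"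
    using Suc(2) by (simp add: word_at_Suc assms add.assoc)
  show "running h (t i) (word_at y i (Suc n)) = word_at (\<lambda>i. (y i, t i)) i (Suc n)"
    using Suc by (simp add: word_at_Suc running_append)
qed simp_all

lemma sum_list_morphism_word:
  "sum_list (map h (morphism_word \<sigma> x)) = sum_list (map (\<lambda>a. sum_list (map h (\<sigma> a))) x)"
  by (induction x) simp_all

text \<open>By \<open>h\<close>, a whole block contributes to \<open>s\<close> what its letter
  \<open>y i\<close> contributes to \<open>t\<close>. Hence \<open>s\<close> at the start of a block
  equals \<open>t\<close> at the index of that block.\<close>

lemma is_morphic_image_running:
  assumes im: "is_morphic_image \<sigma> y w"
    and t: "\<And>i. t (Suc i) = t i + h (y i)" and s: "\<And>i. s (Suc i) = s i + h' (w i)"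
    and init: "t 0 = s 0"
    and h: "\<And>i. sum_list (map h' (\<sigma> (y i))) = h (y i)"
  shows "is_morphic_image (\<lambda>(a, c). running h' c (\<sigma> a)) (\<lambda>i. (y i, t i)) (\<lambda>i. (w i, s i))"
  using im
proof (rule is_morphic_image_transfer)
  fix n
  let ?L = "image_length \<sigma> y n" and ?l = "length (\<sigma> (y n))"
  have "s ?L = s 0 + sum_list (map h' (word_at w 0 ?L))"
    using running_word_at(2)[of s h' w 0 ?L] s by simp
  also have "\<dots> = t 0 + sum_list (map (\<lambda>a. sum_list (map h' (\<sigma> a))) (word_at y 0 n))"
    by (simp add: init sum_list_morphism_word flip: is_morphic_image_prefix[OF im])
  also have "\<dots> = t 0 + sum_list (map h (word_at y 0 n))"
    by (simp add: word_at_def comp_def h)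
  also have "\<dots> = t n"
    using running_word_at(2)[of t h y 0 n] t by simp
  finally have sL: "s ?L = t n" .
  have "running h' (s ?L) (\<sigma> (y n)) = running h' (s ?L) (word_at w ?L ?l)"
    by (rule arg_cong[OF is_morphic_image_block[OF im]])
  also have "\<dots> = word_at (\<lambda>i. (w i, s i)) ?L ?l"
    by (rule running_word_at(1)[of s h' w, OF s])
  finally show "(\<lambda>(a, c). running h' c (\<sigma> a)) (y n, t n) = word_at (\<lambda>i. (w i, s i)) ?L ?l"
    by (simp add: sL)
qed

lemma finite_UNIV_bit: "finite (UNIV :: bit set)"
proof -
  have "a \<in> {0, 1}" for a :: bit by (cases a) simp_all
  then show ?thesis by (metis finite.emptyI finite_insert finite_subset subsetI)
qed

lemma returning_running:
  fixes \<psi> :: "'b \<Rightarrow> 'b list" and h :: "'b \<Rightarrow> bit"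
  assumes ret: "returning_fixed_point \<psi> y"
    and h: "\<And>i. sum_list (map h (\<psi> (y i))) = h (y i)"
    and t: "\<And>i. t (Suc i) = t i + h (y i)"
  shows "returning_fixed_point (\<lambda>(a, c). running h c (\<psi> a)) (\<lambda>i. (y i, t i))"
proof -
  let ?\<psi> = "\<lambda>(a, c). running h c (\<psi> a)" and ?y = "\<lambda>i. (y i, t i)"
  have fixed: "is_morphic_image ?\<psi> ?y ?y"
    by (rule is_morphic_image_running[OF returning_fixed[OF ret] t t refl h])
  have len: "length (?\<psi> (?y 0)) \<ge> 2"
    using returning_length[OF ret] by simp
  have fin: "finite (range ?y)"
    by (rule finite_subset[of _ "range y \<times> UNIV"]) (use returning_finite[OF ret] finite_UNIV_bit in auto)
  have shift: "((a, s + c), (b, s' + c)) \<in> (letter_rel ?\<psi>)\<^sup>*"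
    if "((a, s), (b, s')) \<in> (letter_rel ?\<psi>)\<^sup>*" for a b s s' c
    using that
  proof (induction rule: rtrancl_induct2)
    case (step b s' d s'')
    then have "(d, s'') \<in> set (running h s' (\<psi> b))" by simp
    then have "(d, s'' + c) \<in> (\<lambda>(a, t). (a, t + c)) ` set (running h s' (\<psi> b))"
      by (rule rev_image_eqI) simp
    then have "((b, s' + c), (d, s'' + c)) \<in> letter_rel ?\<psi>"
      by (simp only: letter_rel_iff case_prod_conv running_shift set_map)
    with step.IH show ?case by (meson rtrancl.rtrancl_into_rtrancl)
  qed blast
  have to: "(x, (y 0, t 0)) \<in> (letter_rel ?\<psi>)\<^sup>*" if x_in: "x \<in> range ?y" for x
  proof -
    obtain n where x: "x = (y n, t n)" using x_in by blast
    obtain s where s: "(x, (y 0, s)) \<in> (letter_rel ?\<psi>)\<^sup>*"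
      using rtrancl_lift[of ?\<psi> \<psi> "y n" "y 0" "t n"] returning_to_first[OF ret, of "y n"] x
      by auto
    show ?thesis
    proof (cases "s = t 0")
      case False
      then have s_eq: "t 0 + 1 = s" "s + 1 = t 0" by (cases s; cases "t 0"; simp)+
      \<comment> \<open>As \<open>(y 0, s)\<close> occurs in the lifted sequence, it is reachable
        from the first letter. That path, shifted by 1, leads from \<open>(y 0, s)\<close> back to
        \<open>(y 0, t 0)\<close>, because 1 + 1 = 0.\<close>
      have "(y 0, s) \<in> range ?y" by (rule letter_rel_closed[OF fixed s x_in])
      then obtain i where i: "(y 0, s) = ?y i" by blast
      have "(?y 0, ?y i) \<in> (letter_rel ?\<psi>)\<^sup>*"
        by (rule reachable_from_first[OF fixed len])
          (use returning_nonerasing[OF ret] in \<open>simp flip: length_greater_0_conv\<close>)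
      then have "((y 0, t 0 + 1), (y 0, s + 1)) \<in> (letter_rel ?\<psi>)\<^sup>*"
        unfolding i[symmetric] by (rule shift)
      then have "((y 0, s), (y 0, t 0)) \<in> (letter_rel ?\<psi>)\<^sup>*"
        by (simp only: s_eq)
      with s show ?thesis by (rule rtrancl_trans)
    qed (use s in simp)
  qed
  show ?thesis
    unfolding returning_fixed_point_def using fin fixed len to by blast
qed

section \<open>The two implications\<close>

lemma primitive_substitutive_\<S>:
  assumes "primitive_substitutive v"
  shows "primitive_substitutive (\<S> v)"
proof -
  obtain \<psi> and y :: "nat \<Rightarrow> nat" and \<sigma>
    where ret: "returning_fixed_point \<psi> y" and "is_morphic_image \<sigma> y v"
    using primitive_substitutive_imp_returning[OF assms] by blast
  \<comment> \<open>Pairing reads the first letter of the next block, so the coding must not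
    erase.\<close>
  then obtain \<tau> where \<tau>: "is_morphic_image \<tau> y v" "\<And>a. a \<in> range y \<Longrightarrow> \<tau> a \<noteq> []"
    using returning_nonerasing_coding by blast
  have "is_morphic_image (\<lambda>x. map (\<lambda>(a, b). a + b) (pair_morphism \<tau> x)) (pair_sequence y)
      ((\<lambda>(a, b). a + b) \<circ> pair_sequence v)"
    by (intro is_morphic_image_map is_morphic_image_pair \<tau>)
  moreover have "(\<lambda>(a, b). a + b) \<circ> pair_sequence v = \<S> v"
    by (simp add: fun_eq_iff pair_sequence_def \<S>_def)
  ultimately show ?thesis
    using returning_imp_primitive_substitutive[OF returning_pair[OF ret]] by metis
qed

lemma primitive_substitutive_of_\<S>:
  assumes "primitive_substitutive (\<S> v)"
  shows "primitive_substitutive v"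
proof -
  obtain \<psi> and y :: "nat \<Rightarrow> nat" and \<sigma>
    where ret: "returning_fixed_point \<psi> y" and \<sigma>: "is_morphic_image \<sigma> y (\<S> v)"
    using primitive_substitutive_imp_returning[OF assms] by blast
  \<comment> \<open>\<open>H n\<close> collects the block sums of the \<open>n\<close>-th iterate.
    Restricted to the finitely many occurring letters it has finitely many possible values, so two
    iterates agree.\<close>
  define H where "H n = restrict (\<lambda>a. sum_list (comp_power n \<sigma> \<psi> a)) (range y)" for n
  have "range H \<subseteq> range y \<rightarrow>\<^sub>E UNIV" by (auto simp: H_def)
  moreover have "finite (range y \<rightarrow>\<^sub>E (UNIV :: bit set))"
    by (intro finite_PiE returning_finite[OF ret] finite_UNIV_bit)
  ultimately have "\<not> inj H"
    using finite_subset finite_imageD infinite_UNIV_nat by blast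
  then obtain m n where "m < n" and eq: "H m = H n"
    by (metis injI nat_neq_iff)
  define \<tau> where "\<tau> = comp_power m \<sigma> \<psi>"
  \<comment> \<open>By \<open>H m = H n\<close>, this power leaves the block sums of
    \<open>\<tau>\<close> unchanged.\<close>
  define \<phi> where "\<phi> = comp_power (n - m) (\<lambda>a. [a]) \<psi>"
  define h where "h a = sum_list (\<tau> a)" for a
  \<comment> \<open>Starting at \<open>v 0\<close> aligns these sums with the partial sums of
    \<open>\<S> v\<close>, which recover \<open>v\<close>.\<close>
  define t where "t i = v 0 + (\<Sum>j<i. h (y j))" for i
  have ret': "returning_fixed_point \<phi> y"
    unfolding \<phi>_def using ret \<open>m < n\<close> by (intro returning_comp_power) auto
  have \<tau>: "is_morphic_image \<tau> y (\<S> v)"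
    unfolding \<tau>_def by (rule is_morphic_image_comp_power[OF returning_fixed[OF ret] \<sigma>])
  have inv: "sum_list (map h (\<phi> (y i))) = h (y i)" for i
  proof -
    have "sum_list (map h (\<phi> (y i))) = sum_list (morphism_comp \<tau> \<phi> (y i))"
      using sum_list_morphism_word[of "\<lambda>b. b" \<tau> "\<phi> (y i)"]
      by (simp add: morphism_comp_def h_def[abs_def])
    also have "\<dots> = sum_list (comp_power n \<sigma> \<psi> (y i))"
      using comp_power_add[of m "n - m" \<sigma> \<psi>] \<open>m < n\<close> by (simp add: \<tau>_def \<phi>_def)
    also have "\<dots> = h (y i)"
      using fun_cong[OF eq, of "y i"] by (simp add: H_def h_def \<tau>_def)
    finally show ?thesis .
  qed
  have t: "t (Suc i) = t i + h (y i)" for i by (simp only: t_def sum.lessThan_Suc add.assoc)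
  \<comment> \<open>Subtraction modulo 2 is addition.\<close>
  have v: "v (Suc i) = v i + \<S> v i" for i
    by (cases "v i"; cases "v (Suc i)") (simp_all add: \<S>_def)
  \<comment> \<open>Each letter of \<open>\<S> v\<close> is its own weight here, so the second
    components spell \<open>v\<close>.\<close>
  have "is_morphic_image (\<lambda>(a, c). running (\<lambda>b. b) c (\<tau> a)) (\<lambda>i. (y i, t i)) (\<lambda>i. (\<S> v i, v i))"
    by (rule is_morphic_image_running[OF \<tau> t]) (simp_all add: v t_def h_def)
  then have "is_morphic_image (\<lambda>x. map snd ((\<lambda>(a, c). running (\<lambda>b. b) c (\<tau> a)) x))
      (\<lambda>i. (y i, t i)) (snd \<circ> (\<lambda>i. (\<S> v i, v i)))"
    by (rule is_morphic_image_map)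
  moreover have "snd \<circ> (\<lambda>i. (\<S> v i, v i)) = v" by auto
  ultimately show ?thesis
    using returning_imp_primitive_substitutive[OF returning_running[OF ret' inv t]] by metis
qed

theorem theorem6p3:
  fixes u v :: "nat \<Rightarrow> bit"
  assumes "complementary_symmetric_rote v"
    and "u = \<S> v"
    and "standard_sturmian u"
  shows "primitive_substitutive v \<longleftrightarrow> primitive_substitutive u"
  using assms(2) primitive_substitutive_\<S> primitive_substitutive_of_\<S> by blast

end
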